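(* For every positive integer $m$, $$\min\left(\frac{\lfloor\sqrt{m}\rfloor+1}{m},\ \frac{1}{\lfloor\sqrt{m}\rfloor}\right)\le L_{\min}(m),$$ where $L_{\min}(m)$ is the minimal data storage limit of an ATAC (All-to-All Comparison) data distribution on $m$ machines.
   Context: Let $m$ be a positive integer (the number of machines). A data distribution on $m$ machines is a pair $(D,\vec{s})$, where, for some positive integer $x$ (the number of data groups, not fixed in advance), $D=(d_{ij})$ is an $m\times x$ matrix with entries in $\{0,1\}$ ($d_{ij}=1$ iff data group $j$ is stored on machine $i$), and $\vec{s}\in\mathbb{R}^x$ is a column vector with non-negative entries summing to $1$ ($s_j$ is the fraction of all data lying in data group $j$). It is an ATAC (All-to-All Comparison) data distribution if every entry of $D^TD$ is nonzero, i.e. for every pair of data groups (including a group paired with itself) some machine holds both. The data storage limit of $(D,\vec{s})$ is $L(D,\vec{s})=\max_{1\le i\le m}(D\vec{s})_i$. The minimal data storage limit $L_{\min}(m)$ is the minimum of $L(D,\vec{s})$ over all ATAC data distributions $(D,\vec{s})$ on $m$ machines (over all $x$). *)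

theory Defs
  imports Complex_Main "Jordan_Normal_Form.Matrix"
begin

text \<open>Machines and data groups are indexed from 0, following the matrix library.\<close>

definition data_distribution :: "nat \<Rightarrow> real mat \<Rightarrow> real vec \<Rightarrow> bool" where
  "data_distribution m D s \<longleftrightarrow>
     (\<exists>x>0. D \<in> carrier_mat m x \<and> s \<in> carrier_vec x \<and>
            (\<forall>i<m. \<forall>j<x. D $$ (i, j) \<in> {0, 1}) \<and>
            (\<forall>j<x. 0 \<le> s $ j) \<and> (\<Sum>j<x. s $ j) = 1)"

definition atac_distribution :: "nat \<Rightarrow> real mat \<Rightarrow> real vec \<Rightarrow> bool" where
  "atac_distribution m D s \<longleftrightarrow>
     data_distribution m D s \<and>
     (\<forall>j<dim_col D. \<forall>k<dim_col D. (transpose_mat D * D) $$ (j, k) \<noteq> 0)"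

definition storage_limit :: "real mat \<Rightarrow> real vec \<Rightarrow> real" where
  "storage_limit D s = Max ((\<lambda>i. (D *\<^sub>v s) $ i) ` {..<dim_row D})"

text \<open>
  The minimum over all ATAC distributions, as a genuine minimum rather than an infimum: the
  \<open>LEAST\<close> operator is meaningful only if the minimum is attained. It is attained for every
  positive \<open>m\<close>: merging equal columns leaves finitely many matrices, and for each of them
  the admissible vectors form a compact simplex.
\<close>

definition L_min :: "nat \<Rightarrow> real" where
  "L_min m = (LEAST l. \<exists>D s. atac_distribution m D s \<and> l = storage_limit D s)"

end

theory Submission
  imports Defs "HOL-Analysis.Function_Topology"
begin

text \<open>
  Recording for every set of machines the fraction of data stored on exactly that set turns an
  ATAC distribution into a probability vector on the subsets of \<open>{..<m}\<close> whose support is an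
  intersecting family, and every such vector arises. These vectors form a compact set, so the
  minimum is attained. For the bound let \<open>r = \<lfloor>sqrt m\<rfloor>\<close>. If some set \<open>A\<close> in the support has at
  most \<open>r\<close> elements, then every data group is stored on a machine of \<open>A\<close>, so the loads of these at
  most \<open>r\<close> machines add up to at least \<open>1\<close>. Otherwise all data is stored at least \<open>r + 1\<close> times, and
  the \<open>m\<close> loads add up to at least \<open>r + 1\<close>.
\<close>

text \<open>The intersecting condition is stated as equations \<open>w A * w B = 0\<close>, which
  survive limits, so the set is closed. The case \<open>A = B = {}\<close> forces
  \<open>w {} = 0\<close>.\<close>

definition intersecting_weights :: "nat \<Rightarrow> (nat set \<Rightarrow> real) set" where
  "intersecting_weights m =
     {w. (\<forall>A. 0 \<le> w A) \<and> (\<forall>A. \<not> A \<subseteq> {..<m} \<longrightarrow> w A = 0) \<and> (\<Sum>A\<in>Pow {..<m}. w A) = 1 \<and>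
         (\<forall>A B. A \<inter> B = {} \<longrightarrow> w A * w B = 0)}"

definition load :: "nat \<Rightarrow> (nat set \<Rightarrow> real) \<Rightarrow> nat \<Rightarrow> real" where
  "load m w i = (\<Sum>A | A \<subseteq> {..<m} \<and> i \<in> A. w A)"

definition max_load :: "nat \<Rightarrow> (nat set \<Rightarrow> real) \<Rightarrow> real" where
  "max_load m w = Max (load m w ` {..<m})"

text \<open>The indicator form sums over an index set independent of \<open>i\<close>, so that sums
  over machines and over sets can be exchanged.\<close>

lemma load_altdef: "load m w i = (\<Sum>A\<in>Pow {..<m}. of_bool (i \<in> A) * w A)"
  unfolding load_def by (rule sum.mono_neutral_cong_left) auto

lemma load_le_max_load: "i < m \<Longrightarrow> load m w i \<le> max_load m w"
  unfolding max_load_def by (intro Max_ge) auto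

subsection \<open>The bound for weights\<close>

text \<open>Double counting: each set \<open>B\<close> adds its weight once for every machine in
  \<open>A \<inter> B\<close>.\<close>

lemma sum_load:
  assumes "A \<subseteq> {..<m}"
  shows "(\<Sum>i\<in>A. load m w i) = (\<Sum>B\<in>Pow {..<m}. real (card (A \<inter> B)) * w B)"
proof -
  have fin: "finite A"
    using assms finite_subset by blast
  have "(\<Sum>i\<in>A. load m w i) = (\<Sum>B\<in>Pow {..<m}. \<Sum>i\<in>A. of_bool (i \<in> B) * w B)"
    unfolding load_altdef by (rule sum.swap)
  also have "\<dots> = (\<Sum>B\<in>Pow {..<m}. real (card (A \<inter> B)) * w B)"
    using fin by (simp flip: sum_distrib_right)
  finally show ?thesis .
qed

text \<open>The total load on \<open>A\<close> is a weighted mean of the numbers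
  \<open>card (A \<inter> B)\<close>, and it is at most \<open>card A\<close> times the largest
  load.\<close>

lemma card_times_max_load_ge:
  assumes "w \<in> intersecting_weights m" "A \<subseteq> {..<m}"
    and "\<And>B. w B \<noteq> 0 \<Longrightarrow> c \<le> card (A \<inter> B)"
  shows "real c \<le> real (card A) * max_load m w"
proof -
  have "real c = (\<Sum>B\<in>Pow {..<m}. real c * w B)"
    using assms(1) by (simp add: intersecting_weights_def flip: sum_distrib_left)
  also have "\<dots> \<le> (\<Sum>B\<in>Pow {..<m}. real (card (A \<inter> B)) * w B)"
  proof (rule sum_mono)
    fix B
    show "real c * w B \<le> real (card (A \<inter> B)) * w B"
      using assms(1) assms(3)[of B]
      by (cases "w B = 0") (auto simp: intersecting_weights_def intro!: mult_right_mono)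
  qed
  also have "\<dots> = (\<Sum>i\<in>A. load m w i)"
    using assms(2) by (simp add: sum_load)
  also have "\<dots> \<le> real (card A) * max_load m w"
    using assms(2) by (intro sum_bounded_above load_le_max_load) auto
  finally show ?thesis .
qed

text \<open>The case split works for every positive \<open>r\<close>; taking \<open>r\<close> near
  the square root of \<open>m\<close> roughly balances the two bounds.\<close>

lemma max_load_lower_bound:
  assumes w: "w \<in> intersecting_weights m" and "m > 0" "r > 0"
  shows "min ((real r + 1) / real m) (1 / real r) \<le> max_load m w"
proof (cases "\<exists>A. w A \<noteq> 0 \<and> card A \<le> r")
  case True
  then obtain A where A: "w A \<noteq> 0" "card A \<le> r"
    by blast
  have sub: "A \<subseteq> {..<m}"
    using w A(1) by (auto simp: intersecting_weights_def)
  have meet: "1 \<le> card (A \<inter> B)" if "w B \<noteq> 0" for B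
  proof -
    have "A \<inter> B \<noteq> {}"
      using w A(1) that by (auto simp: intersecting_weights_def)
    moreover have "finite (A \<inter> B)"
      using sub finite_subset by blast
    ultimately show ?thesis
      by (simp add: Suc_le_eq card_gt_0_iff)
  qed
  have ge: "1 \<le> real (card A) * max_load m w"
    using card_times_max_load_ge[OF w sub meet] by simp
  \<comment> \<open>Positivity allows \<open>card A\<close> to be replaced by the larger
    \<open>r\<close>.\<close>
  have "0 < max_load m w"
    using ge by (smt (verit) mult_nonneg_nonpos of_nat_0_le_iff)
  then have "1 \<le> real r * max_load m w"
    using ge A(2) by (smt (verit) mult_right_mono of_nat_le_iff)
  then show ?thesis
    using \<open>r > 0\<close> by (simp add: min_le_iff_disj field_simps)
next
  case False
  have "r + 1 \<le> card ({..<m} \<inter> B)" if "w B \<noteq> 0" for B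
  proof -
    have "{..<m} \<inter> B = B"
      using w that by (auto simp: intersecting_weights_def)
    then show ?thesis
      using False that by (auto simp: not_le Suc_le_eq)
  qed
  from card_times_max_load_ge[OF w order_refl this]
  have "real r + 1 \<le> real m * max_load m w"
    by simp
  then show ?thesis
    using \<open>m > 0\<close> by (simp add: min_le_iff_disj field_simps)
qed

subsection \<open>Existence of a minimum\<close>

lemma continuous_on_coordinate [continuous_intros]:
  "continuous_on S (\<lambda>x. x i :: 'b :: topological_space)"
  by (rule continuous_on_subset[OF continuous_on_product_coordinates]) simp

lemma continuous_on_Max:
  fixes f :: "'i \<Rightarrow> 'a :: topological_space \<Rightarrow> 'b :: linorder_topology"
  assumes "finite I" "I \<noteq> {}" "\<And>i. i \<in> I \<Longrightarrow> continuous_on S (f i)"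
  shows "continuous_on S (\<lambda>x. Max ((\<lambda>i. f i x) ` I))"
  using assms by (induction I rule: finite_ne_induct) (auto intro!: continuous_on_max)

lemma continuous_on_max_load: "m > 0 \<Longrightarrow> continuous_on S (max_load m)"
  unfolding max_load_def [abs_def] load_def
  by (intro continuous_on_Max continuous_intros) auto

text \<open>By Tychonoff the cube of functions with values in \<open>{0..1}\<close> is compact, and
  the weights form a closed subset of it.\<close>

lemma compact_intersecting_weights: "compact (intersecting_weights m)"
proof -
  let ?K = "PiE UNIV (\<lambda>_. {0..1}) :: (nat set \<Rightarrow> real) set"
  have "compactin (product_topology (\<lambda>_. euclidean) UNIV) ?K"
    by (simp add: compactin_PiE)
  then have "compact ?K"
    by (simp add: euclidean_product_topology)
  moreover have "closed (intersecting_weights m)"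
    \<comment> \<open>The premises do not mention \<open>w\<close>, so each implication becomes a
      disjunction of a constant condition and a closed one.\<close>
    unfolding intersecting_weights_def imp_conv_disj
    by (intro closed_Collect_conj closed_Collect_all closed_Collect_disj closed_Collect_const
        closed_Collect_eq closed_Collect_le continuous_intros)
  moreover have "intersecting_weights m \<subseteq> ?K"
  proof
    fix w assume w: "w \<in> intersecting_weights m"
    have "w A \<le> 1" for A
    proof (cases "A \<subseteq> {..<m}")
      case True
      then have "w A \<le> (\<Sum>A\<in>Pow {..<m}. w A)"
        using w by (intro member_le_sum) (auto simp: intersecting_weights_def)
      then show ?thesis
        using w by (simp add: intersecting_weights_def)
    qed (use w in \<open>simp add: intersecting_weights_def\<close>)
    then show "w \<in> ?K"
      using w by (auto simp: intersecting_weights_def)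
  qed
  ultimately show ?thesis
    by (metis compact_Int_closed inf.absorb2)
qed

lemma intersecting_weights_nonempty:
  assumes "m > 0"
  shows "intersecting_weights m \<noteq> {}"
proof -
  \<comment> \<open>The point mass at \<open>{..<m}\<close>: all data is stored on every
    machine.\<close>
  have "(\<lambda>A. of_bool (A = {..<m})) \<in> intersecting_weights m"
    using assms by (auto simp: intersecting_weights_def lessThan_empty_iff)
  then show ?thesis
    by blast
qed

subsection \<open>Distributions and weights\<close>

text \<open>The entries are nonnegative, so the terms of the scalar product cannot cancel.\<close>

lemma transpose_mult_self_nonzero_iff:
  fixes D :: "real mat"
  assumes "D \<in> carrier_mat m x" "\<And>i j. i < m \<Longrightarrow> j < x \<Longrightarrow> D $$ (i, j) \<in> {0, 1}" "j < x" "k < x"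
  shows "(transpose_mat D * D) $$ (j, k) \<noteq> 0 \<longleftrightarrow> (\<exists>i<m. D $$ (i, j) = 1 \<and> D $$ (i, k) = 1)"
proof -
  have "(transpose_mat D * D) $$ (j, k) = (\<Sum>i<m. D $$ (i, j) * D $$ (i, k))"
    using assms by (simp add: scalar_prod_def lessThan_atLeast0)
  also have "\<dots> = 0 \<longleftrightarrow> (\<forall>i<m. D $$ (i, j) * D $$ (i, k) = 0)"
    using assms(2)[OF _ \<open>j < x\<close>] assms(2)[OF _ \<open>k < x\<close>]
    by (subst sum_nonneg_eq_0_iff) force+
  finally show ?thesis
    using assms(2)[OF _ \<open>j < x\<close>] assms(2)[OF _ \<open>k < x\<close>] by fastforce
qed

lemma storage_limit_eq_max_load:
  assumes "D \<in> carrier_mat m x" "s \<in> carrier_vec x"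
    and "\<And>i. i < m \<Longrightarrow> (\<Sum>j<x. D $$ (i, j) * s $ j) = load m w i"
  shows "storage_limit D s = max_load m w"
proof -
  have "(D *\<^sub>v s) $ i = load m w i" if "i < m" for i
    using assms that by (simp add: scalar_prod_def lessThan_atLeast0)
  then show ?thesis
    using assms(1) by (auto simp: storage_limit_def max_load_def intro!: arg_cong[of _ _ Max] image_cong)
qed

lemma weights_of_distribution:
  assumes "atac_distribution m D s"
  obtains w where "w \<in> intersecting_weights m" "storage_limit D s = max_load m w"
proof -
  obtain x where D: "D \<in> carrier_mat m x" and s: "s \<in> carrier_vec x"
    and bin: "\<And>i j. i < m \<Longrightarrow> j < x \<Longrightarrow> D $$ (i, j) \<in> {0, 1}"
    and pos: "\<And>j. j < x \<Longrightarrow> 0 \<le> s $ j" and one: "(\<Sum>j<x. s $ j) = 1"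
    using assms by (auto simp: atac_distribution_def data_distribution_def)
  \<comment> \<open>\<open>c j\<close> is the set of machines holding group \<open>j\<close>;
    \<open>w\<close> is the image of the distribution \<open>s\<close> under \<open>c\<close>, which
    merges equal columns.\<close>
  define c where "c j = {i. i < m \<and> D $$ (i, j) = 1}" for j
  define w where "w A = (\<Sum>j | j < x \<and> c j = A. s $ j)" for A
  have c: "c j \<subseteq> {..<m}" for j
    by (auto simp: c_def)
  have meet: "c j \<inter> c k \<noteq> {}" if "j < x" "k < x" for j k
  proof -
    have "(transpose_mat D * D) $$ (j, k) \<noteq> 0"
      using assms D that by (auto simp: atac_distribution_def)
    with transpose_mult_self_nonzero_iff[OF D bin that] show ?thesis
      by (auto simp: c_def)
  qed
  have supp: "\<exists>j<x. c j = A" if "w A \<noteq> 0" for A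
    using that unfolding w_def by (metis (mono_tags, lifting) mem_Collect_eq sum.neutral)
  \<comment> \<open>Change of variables along \<open>c\<close>: \<open>g = 1\<close> gives the total
    mass, and the indicator of \<open>i \<in> A\<close> gives the load of machine
    \<open>i\<close>.\<close>
  have group: "(\<Sum>A\<in>Pow {..<m}. g A * w A) = (\<Sum>j<x. g (c j) * s $ j)" for g :: "nat set \<Rightarrow> real"
  proof -
    have "(\<Sum>A\<in>Pow {..<m}. g A * w A)
        = (\<Sum>A\<in>Pow {..<m}. \<Sum>j\<in>{j \<in> {..<x}. c j = A}. g (c j) * s $ j)"
      by (simp add: w_def sum_distrib_left)
    also have "\<dots> = (\<Sum>j<x. g (c j) * s $ j)"
      using c by (intro sum.group) auto
    finally show ?thesis .
  qed
  have "w \<in> intersecting_weights m"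
    unfolding intersecting_weights_def
  proof (intro CollectI conjI allI impI)
    show "0 \<le> w A" for A
      using pos by (auto simp: w_def intro: sum_nonneg)
    show "w A = 0" if "\<not> A \<subseteq> {..<m}" for A
      using supp that c by blast
    show "(\<Sum>A\<in>Pow {..<m}. w A) = 1"
      using group[of "\<lambda>_. 1"] one by simp
    show "w A * w B = 0" if "A \<inter> B = {}" for A B
      using supp that meet by (metis mult_eq_0_iff)
  qed
  moreover have "(\<Sum>j<x. D $$ (i, j) * s $ j) = load m w i" if "i < m" for i
    unfolding load_altdef group
    using bin[OF that] that by (intro sum.cong) (fastforce simp: c_def)+
  ultimately show ?thesis
    using that storage_limit_eq_max_load[OF D s] by blast
qed

lemma distribution_of_weights:
  assumes w: "w \<in> intersecting_weights m"
  obtains D s where "atac_distribution m D s" "storage_limit D s = max_load m w"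
proof -
  \<comment> \<open>Only sets of nonzero weight become columns, since the ATAC condition also
    constrains data groups of size zero.\<close>
  define F where "F = {A. w A \<noteq> 0}"
  have F: "F \<subseteq> Pow {..<m}"
    using w by (auto simp: F_def intersecting_weights_def)
  then have "finite F"
    by (rule finite_subset) simp
  define x where "x = card F"
  obtain f where f: "bij_betw f {..<x} F"
    using ex_bij_betw_nat_finite[OF \<open>finite F\<close>] by (auto simp: x_def lessThan_atLeast0)
  have group: "(\<Sum>j<x. g (f j) * w (f j)) = (\<Sum>A\<in>Pow {..<m}. g A * w A)" for g :: "nat set \<Rightarrow> real"
  proof -
    have "(\<Sum>j<x. g (f j) * w (f j)) = (\<Sum>A\<in>F. g A * w A)"
      by (rule sum.reindex_bij_betw[OF f])
    also have "\<dots> = (\<Sum>A\<in>Pow {..<m}. g A * w A)"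
      using F by (intro sum.mono_neutral_left) (auto simp: F_def)
    finally show ?thesis .
  qed
  have one: "(\<Sum>j<x. w (f j)) = 1"
    using group[of "\<lambda>_. 1"] w by (simp add: intersecting_weights_def)
  then have "x > 0"
    by (cases "x = 0") auto
  define D where "D = mat m x (\<lambda>(i, j). of_bool (i \<in> f j) :: real)"
  define s where "s = vec x (\<lambda>j. w (f j))"
  have D: "D \<in> carrier_mat m x" and s: "s \<in> carrier_vec x"
    by (simp_all add: D_def s_def)
  have bin: "D $$ (i, j) \<in> {0, 1}" if "i < m" "j < x" for i j
    using that by (simp add: D_def)
  have "(transpose_mat D * D) $$ (j, k) \<noteq> 0" if "j < x" "k < x" for j k
  proof -
    have "f j \<in> F" "f k \<in> F"
      using f that by (auto simp: bij_betw_def)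
    moreover have "A \<inter> B \<noteq> {}" if "A \<in> F" "B \<in> F" for A B
      using w that by (auto simp: F_def intersecting_weights_def)
    ultimately have "f j \<inter> f k \<noteq> {}" "f j \<subseteq> {..<m}"
      using F by blast+
    then have "\<exists>i<m. D $$ (i, j) = 1 \<and> D $$ (i, k) = 1"
      using that by (auto simp: D_def)
    then show ?thesis
      using transpose_mult_self_nonzero_iff[OF D bin that] by blast
  qed
  moreover have "data_distribution m D s"
    unfolding data_distribution_def
  proof (intro exI[of _ x] conjI allI impI)
    show "0 \<le> s $ j" if "j < x" for j
      using w that by (simp add: s_def intersecting_weights_def)
    show "(\<Sum>j<x. s $ j) = 1"
      using one by (simp add: s_def)
  qed (use \<open>x > 0\<close> D s bin in auto)
  ultimately have "atac_distribution m D s"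
    using D by (auto simp: atac_distribution_def)
  moreover have "(\<Sum>j<x. D $$ (i, j) * s $ j) = load m w i" if "i < m" for i
    unfolding load_altdef group[symmetric]
    using that by (intro sum.cong) (auto simp: D_def s_def)
  ultimately show ?thesis
    using that storage_limit_eq_max_load[OF D s] by blast
qed

text \<open>The two translations show that storage limits of ATAC distributions and values of
  \<open>max_load\<close> on weights are the same numbers; continuity on a compact nonempty set then
  makes the \<open>LEAST\<close> a true minimum.\<close>

lemma L_min_attained:
  assumes "m > 0"
  obtains w where "w \<in> intersecting_weights m" "L_min m = max_load m w"
proof -
  obtain w where w: "w \<in> intersecting_weights m"
    and min: "\<And>v. v \<in> intersecting_weights m \<Longrightarrow> max_load m w \<le> max_load m v"
    using continuous_attains_inf[OF compact_intersecting_weights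
        intersecting_weights_nonempty[OF assms] continuous_on_max_load[OF assms]]
    by blast
  have "L_min m = max_load m w"
    unfolding L_min_def
  proof (rule Least_equality)
    show "\<exists>D s. atac_distribution m D s \<and> max_load m w = storage_limit D s"
      by (metis distribution_of_weights[OF w])
    show "max_load m w \<le> l" if "\<exists>D s. atac_distribution m D s \<and> l = storage_limit D s" for l
      using that min by (metis weights_of_distribution)
  qed
  with w show ?thesis
    using that by blast
qed

theorem theorem4:
  fixes m :: nat
  assumes "m > 0"
  shows "min ((real_of_int \<lfloor>sqrt (real m)\<rfloor> + 1) / real m) (1 / real_of_int \<lfloor>sqrt (real m)\<rfloor>) \<le> L_min m"
proof -
  obtain w where w: "w \<in> intersecting_weights m" "L_min m = max_load m w"
    using L_min_attained[OF assms] .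
  define r where "r = nat \<lfloor>sqrt (real m)\<rfloor>"
  \<comment> \<open>A floor of at least 1 makes \<open>r\<close> positive and its conversion by
    \<open>nat\<close> lossless.\<close>
  have "1 \<le> \<lfloor>sqrt (real m)\<rfloor>"
    using assms by (simp add: le_floor_iff)
  then have "r > 0" "real_of_int \<lfloor>sqrt (real m)\<rfloor> = real r"
    by (auto simp: r_def)
  then show ?thesis
    using max_load_lower_bound[OF w(1) assms] w(2) by simp
qed

end
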